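(* Let $y_h\in\mathcal{Y}^h$ satisfy $\min_k \nabla y_h|_{T_k}>0$, and assume $h_{T_k}\ge 6\varepsilon$ for every $k\in\mathscr{K}^c_{\mathscr{T}_h}$. Put $R^{\rm mo}_\ell:=\sigma^{\rm a}_\ell(y_h)-\sigma^{\rm ac}_\ell(y_h)$ and, for $v\in\mathcal{U}^\varepsilon$, $R_{\rm mo}[v]:=\varepsilon\sum_{\ell\in\mathcal{L}}\sigma^{\rm a}_\ell(y_h)v'_\ell-\varepsilon\sum_{\ell\in\mathcal{L}}\sigma^{\rm ac}_\ell(y_h)v'_\ell$. Then $$\|R_{\rm mo}\|_{\mathcal{U}^{-1,2}}\le\Big\{\sum_{k\in\mathscr{K}^c}(\eta^{\rm mo}_k)^2\Big\}^{1/2}=\Big\{\sum_{k\in\mathscr{K}^c_{\mathscr{T}_h}}(\eta^{\rm mo}_{T_k})^2\Big\}^{1/2},$$ where the nodewise quantities are $$\eta^{\rm mo}_k=\begin{cases}\big\{\varepsilon\sum_{\ell=\ell_k-2}^{\ell_k+3}(R^{\rm mo}_\ell)^2\big\}^{1/2}, & k\in\mathring{\mathscr{K}}^c,\\ \big\{\varepsilon\sum_{\ell=\ell_k-2}^{\ell_k+4}(R^{\rm mo}_\ell)^2\big\}^{1/2}, & k=K_1-2,\\ \big\{\varepsilon\sum_{\ell=\ell_k-3}^{\ell_k+3}(R^{\rm mo}_\ell)^2\big\}^{1/2}, & k=K_2+2,\end{cases}$$ and the elementwise quantities are $$\eta^{\rm mo}_{T_k}=\begin{cases}\Big\{\tfrac12\varepsilon\Big[\sum_{\ell=\ell_{k-1}-2}^{\ell_{k-1}+3}(R^{\rm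 mo}_\ell)^2+\sum_{\ell=\ell_k-2}^{\ell_k+3}(R^{\rm mo}_\ell)^2\Big]\Big\}^{1/2}, & k\in\mathring{\mathscr{K}}^c_{\mathscr{T}_h},\\ \Big\{\tfrac12\varepsilon\sum_{\ell=\ell_{k-1}-2}^{\ell_{k-1}+3}(R^{\rm mo}_\ell)^2+(\eta^{\rm mo}_k)^2\Big\}^{1/2}, & k=K_1-2,\\ \Big\{(\eta^{\rm mo}_{k-1})^2+\tfrac12\varepsilon\sum_{\ell=\ell_k-2}^{\ell_k+3}(R^{\rm mo}_\ell)^2\Big\}^{1/2}, & k=K_2+3.\end{cases}$$
   Context: **Lattice.** $N\in\mathbb{N}$, $\varepsilon=1/N$, $F>0$, $\mathcal{L}=\{-N+1,\dots,N\}$. $\mathcal{U}^\varepsilon$ is the space of $2N$-periodic $v:\mathbb{Z}\to\mathbb{R}$ with $\sum_{\ell\in\mathcal{L}}v_\ell=0$; $\mathcal{Y}^\varepsilon=\{y:\ y_\ell=\varepsilon F\ell+v_\ell,\ v\in\mathcal{U}^\varepsilon\}$. $v'_\ell:=(v_\ell-v_{\ell-1})/\varepsilon$; $D_jy_\ell:=(y_{\ell+j}-y_\ell)/\varepsilon$ for $j\in\{1,2,-1,-2\}$ and $Dy_\ell:=(D_1y_\ell,D_2y_\ell,D_{-1}y_\ell,D_{-2}y_\ell)$. $\|v\|_{\ell^2_\varepsilon(\mathcal{D})}:=(\varepsilon\sum_{\ell\in\mathcal{D}}|v_\ell|^2)^{1/2}$, with $\mathcal{D}=\mathcal{L}$ if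 omitted. For a linear functional $T$ on $\mathcal{U}^\varepsilon$, $\|T\|_{\mathcal{U}^{-1,2}}:=\sup\{T[v]: v\in\mathcal{U}^\varepsilon,\ \|v'\|_{\ell^2_\varepsilon}=1\}$. **Potential.** $V\in C^3((0,\infty)^2\times(-\infty,0)^2;\mathbb{R})$, arguments labelled $(g_1,g_2,g_{-1},g_{-2})$, $\partial_iV=\partial V/\partial g_i$. $W(G):=V(G,2G,-G,-2G)$ for $G>0$. **Mesh.** Nodes $\ell_1<\dots<\ell_K=N$ in $\mathcal{L}$, extended by $\ell_{k+K}=\ell_k+2N$ (all node/element indices are understood $K$-periodically). $T_k=[\varepsilon\ell_{k-1},\varepsilon\ell_k]$, $h_{T_k}=\varepsilon(\ell_k-\ell_{k-1})$, $\mathcal{L}_{T_k}=\{\ell_{k-1}+1,\dots,\ell_k\}$. Indices $K_1,K_2$ satisfy $K_1\ge3$, $K_1+2<K_2-1$, $K_2+3\le K$, and $\ell_k-\ell_{k-1}=1$ for $K_1-1\le k\le K_2+2$ (atomistic nodes: $K_1+1,\dots,K_2-1$; interface nodes: $K_1-1,K_1,K_2,K_2+1$; the rest continuum). $\mathscr{K}^c=\{1,\dots,K_1-2,K_2+2,\dots,K\}$, $\mathring{\mathscr{K}}^c=\mathscr{K}^c\setminus\{K_1-2,K_2+2\}$, $\mathscr{K}^c_{\mathscr{T}_h}=\mathscr{K}^c\setminus\{K_2+2\}$, $\mathring{\mathscr{K}}^c_{\mathscr{T}_h}=\mathscr{K}^c_{\mathscr{T}_h}\setminus\{K_1-2,K_2+3\}$.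 $\mathcal{Y}^h$ is the set of $y\in\mathcal{Y}^\varepsilon$ that are affine on every $T_k$ (i.e. $y'_\ell$ is constant for $\ell\in\mathcal{L}_{T_k}$, the constant being $\nabla y|_{T_k}$). **Stresses.** $\sigma^{\rm a}_\ell(y)=\partial_1V(Dy_{\ell-1})-\partial_{-1}V(Dy_\ell)+\partial_2V(Dy_{\ell-2})+\partial_2V(Dy_{\ell-1})-\partial_{-2}V(Dy_\ell)-\partial_{-2}V(Dy_{\ell+1})$. For $y\in\mathcal{Y}^h$ write $V_j(\ell)=\partial_jV(Dy_\ell)$, $V^-_j(\ell)=\partial_jV(D_1y_\ell,D_2y_\ell,D_{-1}y_\ell,2D_{-1}y_\ell)$, $V^+_j(\ell)=\partial_jV(D_1y_\ell,2D_1y_\ell,D_{-1}y_\ell,D_{-2}y_\ell)$. The coupled elementwise stress $\bar\sigma^{\rm ac}_k(y)$ is: - $W'(\nabla y|_{T_k})$ for $k\in\mathscr{K}^c_{\mathscr{T}_h}$; $\sigma^{\rm a}_{\ell_k}(y)$ for $K_1+3\le k\le K_2-2$; - $k=K_1-1$: $\frac12W'(\nabla y|_{T_k})-V^-_{-1}(\ell_k)-2V^-_{-2}(\ell_k)$; - $k=K_1$: $V^-_1(\ell_{k-1})-V^-_{-1}(\ell_k)+V^-_2(\ell_{k-1})-2V^-_{-2}(\ell_k)-V_{-2}(\ell_{k+1})$; - $k=K_1+1$: $V^-_1(\ell_{k-1})-V_{-1}(\ell_k)+V^-_2(\ell_{k-2})+V^-_2(\ell_{k-1})-V_{-2}(\ell_k)-V_{-2}(\ell_{k+1})$;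 - $k=K_1+2$: $V_1(\ell_{k-1})-V_{-1}(\ell_k)+V^-_2(\ell_{k-2})+V_2(\ell_{k-1})-V_{-2}(\ell_k)-V_{-2}(\ell_{k+1})$; - $k=K_2-1$: $V_1(\ell_{k-1})-V_{-1}(\ell_k)+V_2(\ell_{k-1})+V_2(\ell_{k-2})-V_{-2}(\ell_k)-V^+_{-2}(\ell_{k+1})$; - $k=K_2$: $V_1(\ell_{k-1})-V^+_{-1}(\ell_k)+V_2(\ell_{k-1})+V_2(\ell_{k-2})-V^+_{-2}(\ell_k)-V^+_{-2}(\ell_{k+1})$; - $k=K_2+1$: $V^+_1(\ell_{k-1})-V^+_{-1}(\ell_k)+V_2(\ell_{k-2})+2V^+_2(\ell_{k-1})-V^+_{-2}(\ell_k)$; - $k=K_2+2$: $\frac12W'(\nabla y|_{T_k})+V^+_1(\ell_{k-1})+2V^+_2(\ell_{k-1})$. The latticewise stress is $\sigma^{\rm ac}_\ell(y):=\bar\sigma^{\rm ac}_k(y)$ for $\ell\in\mathcal{L}_{T_k}$, extended $2N$-periodically in $\ell$. *)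

theory Defs
  imports "HOL-Analysis.Analysis"
begin

section \<open>Lattice functions\<close>

definition eps :: "nat \<Rightarrow> real" where
  "eps N = 1 / real N"

definition lattice :: "nat \<Rightarrow> int set" where
  "lattice N = {- int N + 1 .. int N}"

definition U_eps :: "nat \<Rightarrow> (int \<Rightarrow> real) set" where
  "U_eps N = {v. (\<forall>l. v (l + 2 * int N) = v l) \<and> (\<Sum>l\<in>lattice N. v l) = 0}"

definition Y_eps :: "nat \<Rightarrow> real \<Rightarrow> (int \<Rightarrow> real) set" where
  "Y_eps N F = {y. \<exists>v\<in>U_eps N. \<forall>l. y l = eps N * F * of_int l + v l}"

text \<open>The backward difference quotient \<open>v'\<close>.\<close>

definition bdiff :: "nat \<Rightarrow> (int \<Rightarrow> real) \<Rightarrow> int \<Rightarrow> real" where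
  "bdiff N v l = (v l - v (l - 1)) / eps N"

definition D :: "nat \<Rightarrow> int \<Rightarrow> (int \<Rightarrow> real) \<Rightarrow> int \<Rightarrow> real" where
  "D N j y l = (y (l + j) - y l) / eps N"

definition Dvec :: "nat \<Rightarrow> (int \<Rightarrow> real) \<Rightarrow> int \<Rightarrow> real \<times> real \<times> real \<times> real" where
  "Dvec N y l = (D N 1 y l, D N 2 y l, D N (-1) y l, D N (-2) y l)"

definition l2_eps_norm :: "nat \<Rightarrow> int set \<Rightarrow> (int \<Rightarrow> real) \<Rightarrow> real" where
  "l2_eps_norm N A v = sqrt (eps N * (\<Sum>l\<in>A. \<bar>v l\<bar>\<^sup>2))"

text \<open>For \<open>N > 0\<close> and linear \<open>T\<close> the supremum is over a nonempty bounded set of reals, because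
  \<open>U_eps N\<close> has dimension \<open>2 * N - 1\<close> and \<open>v \<mapsto> l2_eps_norm N (lattice N) (bdiff N v)\<close> is a norm on it.\<close>

definition dual_norm :: "nat \<Rightarrow> ((int \<Rightarrow> real) \<Rightarrow> real) \<Rightarrow> real" where
  "dual_norm N T = Sup {T v | v. v \<in> U_eps N \<and> l2_eps_norm N (lattice N) (bdiff N v) = 1}"


section \<open>Interaction potential\<close>

text \<open>\<open>Ck_on n f S\<close> says that \<open>f\<close> is \<open>n\<close> times continuously differentiable on the open set \<open>S\<close>:
  \<open>f\<close> is differentiable and its partial derivatives are of class \<open>n - 1\<close>.\<close>

fun Ck_on :: "nat \<Rightarrow> ('a::euclidean_space \<Rightarrow> real) \<Rightarrow> 'a set \<Rightarrow> bool" where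
  "Ck_on 0 f S \<longleftrightarrow> continuous_on S f"
| "Ck_on (Suc n) f S \<longleftrightarrow>
     (\<forall>x\<in>S. f differentiable (at x)) \<and>
     (\<forall>b\<in>Basis. Ck_on n (\<lambda>x. frechet_derivative f (at x) b) S)"

text \<open>Arguments of the potential are tuples \<open>(g\<^sub>1, g\<^sub>2, g\<^sub>-\<^sub>1, g\<^sub>-\<^sub>2)\<close>; only the labels
  \<open>1\<close>, \<open>2\<close>, \<open>-1\<close>, \<open>-2\<close> are meaningful below.\<close>

definition pot_dom :: "(real \<times> real \<times> real \<times> real) set" where
  "pot_dom = {0<..} \<times> {0<..} \<times> {..<0} \<times> {..<0}"

definition unit_dir :: "int \<Rightarrow> real \<times> real \<times> real \<times> real" where
  "unit_dir j =
     (if j = 1 then (1, 0, 0, 0)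
      else if j = 2 then (0, 1, 0, 0)
      else if j = -1 then (0, 0, 1, 0)
      else if j = -2 then (0, 0, 0, 1)
      else 0)"

definition pd :: "int \<Rightarrow> (real \<times> real \<times> real \<times> real \<Rightarrow> real) \<Rightarrow>
    real \<times> real \<times> real \<times> real \<Rightarrow> real" where
  "pd j V g = frechet_derivative V (at g) (unit_dir j)"

definition W :: "(real \<times> real \<times> real \<times> real \<Rightarrow> real) \<Rightarrow> real \<Rightarrow> real" where
  "W V G = V (G, 2 * G, - G, - 2 * G)"


section \<open>Mesh\<close>

text \<open>The node map \<open>nd\<close> is defined on all of \<open>int\<close>, in its periodically extended form; in particular
  \<open>nd 0 = - int N\<close>.\<close>

definition is_mesh :: "nat \<Rightarrow> int \<Rightarrow> int \<Rightarrow> int \<Rightarrow> (int \<Rightarrow> int) \<Rightarrow> bool" where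
  "is_mesh N K K1 K2 nd \<longleftrightarrow>
     strict_mono_on {1..K} nd \<and>
     nd ` {1..K} \<subseteq> lattice N \<and>
     nd K = int N \<and>
     (\<forall>k. nd (k + K) = nd k + 2 * int N) \<and>
     3 \<le> K1 \<and> K1 + 2 < K2 - 1 \<and> K2 + 3 \<le> K \<and>
     (\<forall>k\<in>{K1 - 1..K2 + 2}. nd k - nd (k - 1) = 1)"

definition elt_size :: "nat \<Rightarrow> (int \<Rightarrow> int) \<Rightarrow> int \<Rightarrow> real" where
  "elt_size N nd k = eps N * of_int (nd k - nd (k - 1))"

definition elt_lattice :: "(int \<Rightarrow> int) \<Rightarrow> int \<Rightarrow> int set" where
  "elt_lattice nd k = {nd (k - 1) + 1 .. nd k}"

definition Kc :: "int \<Rightarrow> int \<Rightarrow> int \<Rightarrow> int set" where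
  "Kc K K1 K2 = {1..K1 - 2} \<union> {K2 + 2..K}"

definition Kc_int :: "int \<Rightarrow> int \<Rightarrow> int \<Rightarrow> int set" where
  "Kc_int K K1 K2 = Kc K K1 K2 - {K1 - 2, K2 + 2}"

definition KcT :: "int \<Rightarrow> int \<Rightarrow> int \<Rightarrow> int set" where
  "KcT K K1 K2 = Kc K K1 K2 - {K2 + 2}"

definition KcT_int :: "int \<Rightarrow> int \<Rightarrow> int \<Rightarrow> int set" where
  "KcT_int K K1 K2 = KcT K K1 K2 - {K1 - 2, K2 + 3}"

definition Y_h :: "nat \<Rightarrow> real \<Rightarrow> int \<Rightarrow> (int \<Rightarrow> int) \<Rightarrow> (int \<Rightarrow> real) set" where
  "Y_h N F K nd =
     {y \<in> Y_eps N F. \<forall>k\<in>{1..K}. \<exists>c. \<forall>l\<in>elt_lattice nd k. bdiff N y l = c}"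

text \<open>The slope of \<open>y\<close> on an element, read off at the last lattice point \<open>nd k\<close> of that element;
  for \<open>y \<in> Y_h N F K nd\<close> every other point of \<open>elt_lattice nd k\<close> gives the same value.\<close>

definition grad :: "nat \<Rightarrow> (int \<Rightarrow> int) \<Rightarrow> (int \<Rightarrow> real) \<Rightarrow> int \<Rightarrow> real" where
  "grad N nd y k = bdiff N y (nd k)"


section \<open>Stresses\<close>

definition sigma_a ::
  "nat \<Rightarrow> (real \<times> real \<times> real \<times> real \<Rightarrow> real) \<Rightarrow> (int \<Rightarrow> real) \<Rightarrow> int \<Rightarrow> real" where
  "sigma_a N V y l =
     pd 1 V (Dvec N y (l - 1)) - pd (-1) V (Dvec N y l)
     + pd 2 V (Dvec N y (l - 2)) + pd 2 V (Dvec N y (l - 1))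
     - pd (-2) V (Dvec N y l) - pd (-2) V (Dvec N y (l + 1))"

definition Vm ::
  "nat \<Rightarrow> (real \<times> real \<times> real \<times> real \<Rightarrow> real) \<Rightarrow> (int \<Rightarrow> real) \<Rightarrow> int \<Rightarrow> int \<Rightarrow> real" where
  "Vm N V y j l = pd j V (D N 1 y l, D N 2 y l, D N (-1) y l, 2 * D N (-1) y l)"

definition Vp ::
  "nat \<Rightarrow> (real \<times> real \<times> real \<times> real \<Rightarrow> real) \<Rightarrow> (int \<Rightarrow> real) \<Rightarrow> int \<Rightarrow> int \<Rightarrow> real" where
  "Vp N V y j l = pd j V (D N 1 y l, 2 * D N 1 y l, D N (-1) y l, D N (-2) y l)"

text \<open>The conditions below are pairwise exclusive and cover all \<open>k \<in> {1..K}\<close>.\<close>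

definition sigma_ac_elt ::
  "nat \<Rightarrow> (real \<times> real \<times> real \<times> real \<Rightarrow> real) \<Rightarrow> int \<Rightarrow> int \<Rightarrow> int \<Rightarrow> (int \<Rightarrow> int) \<Rightarrow>
    (int \<Rightarrow> real) \<Rightarrow> int \<Rightarrow> real" where
  "sigma_ac_elt N V K K1 K2 nd y k =
    (let v = (\<lambda>j l. pd j V (Dvec N y l));
         vm = Vm N V y;
         vp = Vp N V y;
         dW = deriv (W V) (grad N nd y k)
     in
      if k \<in> KcT K K1 K2 then dW
      else if K1 + 3 \<le> k \<and> k \<le> K2 - 2 then sigma_a N V y (nd k)
      else if k = K1 - 1 then
        1/2 * dW - vm (-1) (nd k) - 2 * vm (-2) (nd k)
      else if k = K1 then
        vm 1 (nd (k - 1)) - vm (-1) (nd k) + vm 2 (nd (k - 1))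
        - 2 * vm (-2) (nd k) - v (-2) (nd (k + 1))
      else if k = K1 + 1 then
        vm 1 (nd (k - 1)) - v (-1) (nd k) + vm 2 (nd (k - 2)) + vm 2 (nd (k - 1))
        - v (-2) (nd k) - v (-2) (nd (k + 1))
      else if k = K1 + 2 then
        v 1 (nd (k - 1)) - v (-1) (nd k) + vm 2 (nd (k - 2)) + v 2 (nd (k - 1))
        - v (-2) (nd k) - v (-2) (nd (k + 1))
      else if k = K2 - 1 then
        v 1 (nd (k - 1)) - v (-1) (nd k) + v 2 (nd (k - 1)) + v 2 (nd (k - 2))
        - v (-2) (nd k) - vp (-2) (nd (k + 1))
      else if k = K2 then
        v 1 (nd (k - 1)) - vp (-1) (nd k) + v 2 (nd (k - 1)) + v 2 (nd (k - 2))
        - vp (-2) (nd k) - vp (-2) (nd (k + 1))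
      else if k = K2 + 1 then
        vp 1 (nd (k - 1)) - vp (-1) (nd k) + v 2 (nd (k - 2)) + 2 * vp 2 (nd (k - 1))
        - vp (-2) (nd k)
      else if k = K2 + 2 then
        1/2 * dW + vp 1 (nd (k - 1)) + 2 * vp 2 (nd (k - 1))
      else 0)"

text \<open>\<open>wrap N l\<close> is the representative of \<open>l\<close> modulo \<open>2 * N\<close> in \<open>lattice N\<close>.\<close>

definition wrap :: "nat \<Rightarrow> int \<Rightarrow> int" where
  "wrap N l = (l + int N - 1) mod (2 * int N) - int N + 1"

definition elt_of :: "int \<Rightarrow> (int \<Rightarrow> int) \<Rightarrow> int \<Rightarrow> int" where
  "elt_of K nd l = (THE k. k \<in> {1..K} \<and> l \<in> elt_lattice nd k)"

definition sigma_ac ::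
  "nat \<Rightarrow> (real \<times> real \<times> real \<times> real \<Rightarrow> real) \<Rightarrow> int \<Rightarrow> int \<Rightarrow> int \<Rightarrow> (int \<Rightarrow> int) \<Rightarrow>
    (int \<Rightarrow> real) \<Rightarrow> int \<Rightarrow> real" where
  "sigma_ac N V K K1 K2 nd y l = sigma_ac_elt N V K K1 K2 nd y (elt_of K nd (wrap N l))"


section \<open>Modelling residual and error indicators\<close>

definition R_mo_lat ::
  "nat \<Rightarrow> (real \<times> real \<times> real \<times> real \<Rightarrow> real) \<Rightarrow> int \<Rightarrow> int \<Rightarrow> int \<Rightarrow> (int \<Rightarrow> int) \<Rightarrow>
    (int \<Rightarrow> real) \<Rightarrow> int \<Rightarrow> real" where
  "R_mo_lat N V K K1 K2 nd y l = sigma_a N V y l - sigma_ac N V K K1 K2 nd y l"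

definition R_mo ::
  "nat \<Rightarrow> (real \<times> real \<times> real \<times> real \<Rightarrow> real) \<Rightarrow> int \<Rightarrow> int \<Rightarrow> int \<Rightarrow> (int \<Rightarrow> int) \<Rightarrow>
    (int \<Rightarrow> real) \<Rightarrow> (int \<Rightarrow> real) \<Rightarrow> real" where
  "R_mo N V K K1 K2 nd y v =
     eps N * (\<Sum>l\<in>lattice N. sigma_a N V y l * bdiff N v l)
     - eps N * (\<Sum>l\<in>lattice N. sigma_ac N V K K1 K2 nd y l * bdiff N v l)"

definition eta_mo ::
  "nat \<Rightarrow> (real \<times> real \<times> real \<times> real \<Rightarrow> real) \<Rightarrow> int \<Rightarrow> int \<Rightarrow> int \<Rightarrow> (int \<Rightarrow> int) \<Rightarrow>
    (int \<Rightarrow> real) \<Rightarrow> int \<Rightarrow> real" where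
  "eta_mo N V K K1 K2 nd y k =
    (let R = R_mo_lat N V K K1 K2 nd y in
      if k \<in> Kc_int K K1 K2 then sqrt (eps N * (\<Sum>l = nd k - 2..nd k + 3. (R l)\<^sup>2))
      else if k = K1 - 2 then sqrt (eps N * (\<Sum>l = nd k - 2..nd k + 4. (R l)\<^sup>2))
      else if k = K2 + 2 then sqrt (eps N * (\<Sum>l = nd k - 3..nd k + 3. (R l)\<^sup>2))
      else 0)"

definition eta_mo_elt ::
  "nat \<Rightarrow> (real \<times> real \<times> real \<times> real \<Rightarrow> real) \<Rightarrow> int \<Rightarrow> int \<Rightarrow> int \<Rightarrow> (int \<Rightarrow> int) \<Rightarrow>
    (int \<Rightarrow> real) \<Rightarrow> int \<Rightarrow> real" where
  "eta_mo_elt N V K K1 K2 nd y k =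
    (let R = R_mo_lat N V K K1 K2 nd y;
         \<eta> = eta_mo N V K K1 K2 nd y
     in
      if k \<in> KcT_int K K1 K2 then
        sqrt (1/2 * eps N * ((\<Sum>l = nd (k - 1) - 2..nd (k - 1) + 3. (R l)\<^sup>2)
                             + (\<Sum>l = nd k - 2..nd k + 3. (R l)\<^sup>2)))
      else if k = K1 - 2 then
        sqrt (1/2 * eps N * (\<Sum>l = nd (k - 1) - 2..nd (k - 1) + 3. (R l)\<^sup>2) + (\<eta> k)\<^sup>2)
      else if k = K2 + 3 then
        sqrt ((\<eta> (k - 1))\<^sup>2 + 1/2 * eps N * (\<Sum>l = nd k - 2..nd k + 3. (R l)\<^sup>2))
      else 0)"

end

theory Submission
  imports Defs
begin

text \<open>By the Cauchy--Schwarz inequality the dual norm is at most the \<open>\<ell>\<^sup>2\<^sub>\<epsilon>\<close> norm of the residual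
  over one period. The atomistic stress at \<open>\<ell>\<close> only sees the slopes at \<open>\<ell> - 3, \<dots>, \<ell> + 3\<close>, so it
  equals the Cauchy--Born stress unless \<open>\<ell>\<close> lies within \<open>\<ell>\<^sub>k - 2, \<dots>, \<ell>\<^sub>k + 3\<close> for some node; together
  with the interface points this confines the residual to the patches of the nodewise indicators.
  Distributing each nodewise indicator evenly over the two adjacent elements gives the elementwise
  form, the nodes \<open>0\<close> and \<open>K\<close> being identified by periodicity.\<close>

section \<open>Sums over integer intervals, periods and overlapping covers\<close>

lemma sum_shift_interval_int:
  fixes f :: "int \<Rightarrow> 'a::comm_monoid_add"
  shows "(\<Sum>l = a + p..b + p. f l) = (\<Sum>l = a..b. f (l + p))"
  by (rule sum.reindex_bij_witness[of _ "\<lambda>l. l + p" "\<lambda>l. l - p"]) auto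

text \<open>Advancing the window by one point trades its first point for the one a period later,
  where \<open>f\<close> has the same value.\<close>

lemma sum_periodic_shift:
  fixes f :: "int \<Rightarrow> 'a::comm_monoid_add"
  assumes "\<And>l. f (l + p) = f l" and "p > 0"
  shows "(\<Sum>l = a + int n + 1..a + int n + p. f l) = (\<Sum>l = a + 1..a + p. f l)"
proof (induction n)
  case (Suc n)
  let ?b = "a + int n"
  have 1: "{?b + 1..?b + p} = insert (?b + 1) {?b + 2..?b + p}"
    and 2: "{?b + 2..?b + 1 + p} = insert (?b + 1 + p) {?b + 2..?b + p}"
    using \<open>p > 0\<close> by auto
  have "(\<Sum>l = ?b + 2..?b + 1 + p. f l) = (\<Sum>l = ?b + 1..?b + p. f l)"
    unfolding 1 2 using assms(1)[of "?b + 1"] by (simp add: add.assoc)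
  then show ?case
    using Suc by (simp add: algebra_simps)
qed simp

text \<open>The sets \<open>B i\<close> may overlap: a point covered several times is counted
  several times on the right, which is harmless for nonnegative \<open>f\<close>.\<close>

lemma sum_le_sum_cover:
  fixes f :: "'a \<Rightarrow> real"
  assumes "finite A" "finite I" "\<And>i. i \<in> I \<Longrightarrow> finite (B i)"
    and "\<And>x. f x \<ge> 0"
    and "\<And>x. x \<in> A \<Longrightarrow> f x \<noteq> 0 \<Longrightarrow> \<exists>i\<in>I. x \<in> B i"
  shows "sum f A \<le> (\<Sum>i\<in>I. sum f (B i))"
proof -
  have "sum f A = sum f {x \<in> A. f x \<noteq> 0}"
    using assms(1) by (intro sum.mono_neutral_right) auto
  also have "\<dots> \<le> (\<Sum>z\<in>Sigma I B. f (snd z))"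
    using assms by (intro sum_le_included[where i = snd]) (auto simp: image_iff)
  also have "\<dots> = (\<Sum>i\<in>I. sum f (B i))"
    using assms by (simp add: sum.Sigma split_beta)
  finally show ?thesis .
qed

subsection \<open>Lattice functions and the dual norm\<close>

lemma lattice_sum_alternating: "(\<Sum>l\<in>lattice N. if even l then 1 else (-1::real)) = 0"
proof (induction N)
  case 0
  then show ?case by (simp add: lattice_def)
next
  case (Suc N)
  have "lattice (Suc N) = insert (- int N) (insert (int N + 1) (lattice N))"
    by (auto simp: lattice_def)
  then show ?case
    using Suc by (simp add: lattice_def)
qed

text \<open>Bounding the supremum in \<open>dual_norm\<close> from above requires a nonempty set.
  The sawtooth function alternating in sign has mean zero and, up to scaling, supplies an
  element.\<close>

lemma unit_test_function_exists:
  assumes "N > 0"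
  shows "\<exists>v\<in>U_eps N. l2_eps_norm N (lattice N) (bdiff N v) = 1"
proof -
  define s :: "int \<Rightarrow> real" where "s l = (if even l then 1 else - 1)" for l
  have e: "eps N > 0" using assms by (simp add: eps_def)
  have s: "s (l - 1) = - s l" "\<bar>s l\<bar> = 1" for l by (auto simp: s_def)
  \<comment> \<open>The difference quotient of \<open>c * s\<close> has modulus
    \<open>2 * c / eps N\<close> everywhere, and the weights \<open>eps N\<close> of the
    \<open>2 * N\<close> lattice points add up to 2; this \<open>c\<close> makes the norm 1.\<close>
  define c where "c = eps N / (2 * sqrt 2)"
  have "v \<in> U_eps N \<and> l2_eps_norm N (lattice N) (bdiff N v) = 1"
    if v: "v = (\<lambda>l. c * s l)" for v
  proof
    have "(\<Sum>l\<in>lattice N. s l) = 0"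
      using lattice_sum_alternating[of N] by (simp add: s_def)
    then have "(\<Sum>l\<in>lattice N. c * s l) = 0"
      by (simp flip: sum_distrib_left)
    then show "v \<in> U_eps N"
      by (simp add: v U_eps_def s_def)
    have "bdiff N v l = s l / sqrt 2" for l
      using e by (simp add: bdiff_def v s c_def field_simps)
    then have sq: "(bdiff N v l)\<^sup>2 = 1 / 2" for l
      using s(2)[of l] by (simp add: power_divide abs_square_eq_1)
    have "(\<Sum>l\<in>lattice N. (bdiff N v l)\<^sup>2) = real (card (lattice N)) / 2"
      by (simp add: sq)
    moreover have "card (lattice N) = 2 * N"
      by (simp add: lattice_def)
    ultimately show "l2_eps_norm N (lattice N) (bdiff N v) = 1"
      using assms by (simp add: l2_eps_norm_def eps_def)
  qed
  then show ?thesis by blast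
qed

lemma dual_norm_le:
  assumes "N > 0"
    and T: "\<And>v. T v = eps N * (\<Sum>l\<in>lattice N. R l * bdiff N v l)"
  shows "dual_norm N T \<le> sqrt (eps N * (\<Sum>l\<in>lattice N. (R l)\<^sup>2))"
  unfolding dual_norm_def
proof (rule cSup_least)
  show "{T v |v. v \<in> U_eps N \<and> l2_eps_norm N (lattice N) (bdiff N v) = 1} \<noteq> {}"
    using unit_test_function_exists[OF assms(1)] by blast
next
  fix x assume "x \<in> {T v |v. v \<in> U_eps N \<and> l2_eps_norm N (lattice N) (bdiff N v) = 1}"
  then obtain v where x: "x = T v" and v: "l2_eps_norm N (lattice N) (bdiff N v) = 1"
    by blast
  have e: "eps N \<ge> 0" by (simp add: eps_def)
  have 1: "eps N * (\<Sum>l\<in>lattice N. (bdiff N v l)\<^sup>2) = 1"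
    using v by (simp add: l2_eps_norm_def)
  have "(T v)\<^sup>2 = (eps N)\<^sup>2 * (\<Sum>l\<in>lattice N. R l * bdiff N v l)\<^sup>2"
    by (simp add: T power_mult_distrib)
  also have "\<dots> \<le> (eps N)\<^sup>2 * ((\<Sum>l\<in>lattice N. (R l)\<^sup>2) * (\<Sum>l\<in>lattice N. (bdiff N v l)\<^sup>2))"
    by (intro mult_left_mono Cauchy_Schwarz_ineq_sum) simp
  also have "\<dots> = (eps N * (\<Sum>l\<in>lattice N. (R l)\<^sup>2)) * (eps N * (\<Sum>l\<in>lattice N. (bdiff N v l)\<^sup>2))"
    by (simp add: power2_eq_square)
  finally have "(T v)\<^sup>2 \<le> eps N * (\<Sum>l\<in>lattice N. (R l)\<^sup>2)"
    by (simp add: 1)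
  then show "x \<le> sqrt (eps N * (\<Sum>l\<in>lattice N. (R l)\<^sup>2))"
    unfolding x by (rule real_le_rsqrt)
qed

lemma D_periodic:
  assumes "y \<in> Y_eps N F"
  shows "D N j y (l + 2 * int N) = D N j y l"
proof -
  obtain v where v: "\<And>l. v (l + 2 * int N) = v l" "\<And>l. y l = eps N * F * of_int l + v l"
    using assms by (auto simp: Y_eps_def U_eps_def)
  have "v (l + 2 * int N + j) = v (l + j)"
    using v(1)[of "l + j"] by (simp add: algebra_simps)
  then show ?thesis
    using v(1)[of l] by (simp add: D_def v(2) algebra_simps)
qed

subsection \<open>The Cauchy--Born stress\<close>

text \<open>Chain rule along the ray \<open>t\<close> to \<open>(t, 2 * t, - t, - 2 * t)\<close>;
  the coefficients are the components of its direction.\<close>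

lemma deriv_W:
  assumes "Ck_on 3 V pot_dom" "G > 0"
  defines "g \<equiv> (G, 2 * G, - G, - 2 * G)"
  shows "deriv (W V) G = pd 1 V g - pd (-1) V g + 2 * pd 2 V g - 2 * pd (-2) V g"
proof -
  have "g \<in> pot_dom" using assms by (simp add: pot_dom_def g_def)
  then have "V differentiable (at g)"
    using assms(1) by (simp add: numeral_3_eq_3)
  then have V: "(V has_derivative frechet_derivative V (at g)) (at g)"
    by (simp add: frechet_derivative_works)
  then interpret linear "frechet_derivative V (at g)"
    by (rule has_derivative_linear)
  let ?p = "\<lambda>t::real. (t, 2 * t, - t, - 2 * t)"
  have p: "(?p has_derivative ?p) (at G)"
    by (auto intro!: derivative_eq_intros)
  have "(W V has_derivative (\<lambda>t. frechet_derivative V (at g) (?p t))) (at G)"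
    using diff_chain_at[OF p, of V "frechet_derivative V (at g)"] V
    by (simp add: o_def W_def[abs_def] g_def)
  moreover have "frechet_derivative V (at g) (?p t)
      = (pd 1 V g - pd (-1) V g + 2 * pd 2 V g - 2 * pd (-2) V g) * t" for t
  proof -
    have "?p t = t *\<^sub>R (unit_dir 1 + 2 *\<^sub>R unit_dir 2 - unit_dir (-1) - 2 *\<^sub>R unit_dir (-2))"
      by (simp add: unit_dir_def)
    then show ?thesis
      by (simp only: scale add diff pd_def real_scaleR_def) (simp add: algebra_simps)
  qed
  ultimately have "(W V has_field_derivative
      pd 1 V g - pd (-1) V g + 2 * pd 2 V g - 2 * pd (-2) V g) (at G)"
    by (simp add: has_field_derivative_def)
  then show ?thesis by (rule DERIV_imp_deriv)
qed

text \<open>The stress evaluates \<open>Dvec\<close> at \<open>l - 2\<close> to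
  \<open>l + 1\<close>, and \<open>Dvec\<close> at \<open>m\<close> involves the slopes at
  \<open>m - 1\<close> to \<open>m + 2\<close>; together these are the slopes at
  \<open>l - 3\<close> to \<open>l + 3\<close>. When they agree, the six terms combine to the
  Cauchy--Born stress.\<close>

lemma sigma_a_eq_deriv_W:
  assumes "Ck_on 3 V pot_dom" "G > 0"
    and G: "\<And>m. m \<in> {l - 3..l + 3} \<Longrightarrow> bdiff N y m = G"
  shows "sigma_a N V y l = deriv (W V) G"
proof -
  have Dv: "Dvec N y m = (G, 2 * G, - G, - 2 * G)" if "m \<in> {l - 2..l + 1}" for m
  proof -
    have "bdiff N y (m - 1) = G" "bdiff N y m = G" "bdiff N y (m + 1) = G" "bdiff N y (m + 2) = G"
      using that by (auto intro: G)
    moreover have "D N 1 y m = bdiff N y (m + 1)"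
      "D N 2 y m = bdiff N y (m + 1) + bdiff N y (m + 2)"
      "D N (-1) y m = - bdiff N y m"
      "D N (-2) y m = - (bdiff N y m + bdiff N y (m - 1))"
      by (simp_all add: D_def bdiff_def diff_divide_distrib algebra_simps)
    ultimately show ?thesis
      by (simp add: Dvec_def)
  qed
  show ?thesis
    by (simp add: sigma_a_def Dv deriv_W[OF assms(1,2)])
qed

subsection \<open>Meshes\<close>

lemma mesh_zero_node: "is_mesh N K K1 K2 nd \<Longrightarrow> nd 0 = - int N"
proof -
  assume m: "is_mesh N K K1 K2 nd"
  then have "\<And>k. nd (k + K) = nd k + 2 * int N" "nd K = int N"
    by (simp_all add: is_mesh_def)
  from this(1)[of 0] this(2) show ?thesis by simp
qed

text \<open>Monotonicity is given on \<open>{1..K}\<close> only. Node 0 is added because it sits at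
  \<open>- int N\<close>, just left of the lattice.\<close>

lemma mesh_mono:
  assumes "is_mesh N K K1 K2 nd" "0 \<le> i" "i \<le> j" "j \<le> K"
  shows "nd i \<le> nd j"
proof (cases "i = 0")
  case True
  show ?thesis
  proof (cases "j = 0")
    case False
    then have "nd j \<in> lattice N" using assms True by (auto simp: is_mesh_def)
    then show ?thesis using mesh_zero_node[OF assms(1)] True by (simp add: lattice_def)
  qed (use True in simp)
next
  case False
  have "strict_mono_on {1..K} nd" using assms by (simp add: is_mesh_def)
  then have "mono_on {1..K} nd" by (rule strict_mono_on_imp_mono_on)
  then show ?thesis using False assms by (auto elim!: mono_onD)
qed

lemma elt_of_eqI:
  assumes "is_mesh N K K1 K2 nd" "k \<in> {1..K}" "l \<in> elt_lattice nd k"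
  shows "elt_of K nd l = k"
  unfolding elt_of_def
proof (rule the_equality)
  fix j assume j: "j \<in> {1..K} \<and> l \<in> elt_lattice nd j"
  have "\<not> j < k" using mesh_mono[OF assms(1), of j "k - 1"] assms j by (auto simp: elt_lattice_def)
  moreover have "\<not> k < j"
    using mesh_mono[OF assms(1), of k "j - 1"] assms j by (auto simp: elt_lattice_def)
  ultimately show "j = k" by simp
qed (use assms in simp)

lemma elements_cover:
  fixes nd :: "int \<Rightarrow> int"
  assumes "0 \<le> j" "nd 0 < l" "l \<le> nd j"
  shows "\<exists>k\<in>{1..j}. l \<in> elt_lattice nd k"
  using assms
proof (induction j rule: int_ge_induct)
  case (step j)
  show ?case
  proof (cases "l \<le> nd j")
    case True
    then obtain k where "k \<in> {1..j}" "l \<in> elt_lattice nd k"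
      using step by blast
    then show ?thesis by (intro bexI[of _ k]) auto
  next
    case False
    then show ?thesis using step by (intro bexI[of _ "j + 1"]) (auto simp: elt_lattice_def)
  qed
qed simp

lemma wrap_periodic: "wrap N (l + 2 * int N) = wrap N l"
proof -
  have "l + 2 * int N + int N - 1 = (l + int N - 1) + 2 * int N" by simp
  then show ?thesis unfolding wrap_def by (metis mod_add_self2)
qed

lemma wrap_lattice: "l \<in> lattice N \<Longrightarrow> wrap N l = l"
  by (simp add: wrap_def lattice_def)

subsection \<open>Support of the modelling residual\<close>

lemma R_mo_lat_periodic:
  assumes "y \<in> Y_eps N F"
  shows "R_mo_lat N V K K1 K2 nd y (l + 2 * int N) = R_mo_lat N V K K1 K2 nd y l"
proof -
  have "Dvec N y (m + 2 * int N) = Dvec N y m" for m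
    by (simp add: Dvec_def D_periodic[OF assms])
  from this[of "l - 1"] this[of l] this[of "l - 2"] this[of "l + 1"]
  have "sigma_a N V y (l + 2 * int N) = sigma_a N V y l"
    by (simp add: sigma_a_def algebra_simps)
  then show ?thesis
    by (simp add: R_mo_lat_def sigma_ac_def wrap_periodic)
qed

text \<open>On \<open>Kc\<close> this is the summation window of \<open>eta_mo\<close> in all three
  cases at once. The two exceptional nodes reach one point further towards the atomistic
  region.\<close>

definition node_patch :: "int \<Rightarrow> int \<Rightarrow> (int \<Rightarrow> int) \<Rightarrow> int \<Rightarrow> int set" where
  "node_patch K1 K2 nd k =
     {nd k - (if k = K2 + 2 then 3 else 2)..nd k + (if k = K1 - 2 then 4 else 3)}"

lemma eta_mo_squared:
  assumes "is_mesh N K K1 K2 nd" "k \<in> Kc K K1 K2"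
  shows "(eta_mo N V K K1 K2 nd y k)\<^sup>2
    = eps N * (\<Sum>l\<in>node_patch K1 K2 nd k. (R_mo_lat N V K K1 K2 nd y l)\<^sup>2)"
proof -
  have "eps N * (\<Sum>l\<in>A. (R_mo_lat N V K K1 K2 nd y l)\<^sup>2) \<ge> 0" for A
    by (simp add: eps_def sum_nonneg)
  moreover have "K1 - 2 \<noteq> K2 + 2"
    using assms(1) by (simp add: is_mesh_def)
  ultimately show ?thesis
    using assms(2) by (auto simp: eta_mo_def Kc_int_def node_patch_def Let_def)
qed

text \<open>Off the patches, \<open>l\<close> is either deep inside a continuum element, where both
  stresses are Cauchy--Born, or in the atomistic core, where they coincide by definition. The bound
  \<open>nd 0 + 4\<close> stands in for the patch of node 0, whose index is not in
  \<open>Kc\<close>.\<close>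

lemma R_mo_lat_zero_outside_patches:
  assumes V: "Ck_on 3 V pot_dom" and mesh: "is_mesh N K K1 K2 nd" and y: "y \<in> Y_h N F K nd"
    and pos: "\<And>k. k \<in> {1..K} \<Longrightarrow> grad N nd y k > 0"
    and l: "nd 0 + 4 \<le> l" "l \<le> nd K"
    and out: "\<And>k. k \<in> Kc K K1 K2 \<Longrightarrow> l \<notin> node_patch K1 K2 nd k"
  shows "R_mo_lat N V K K1 K2 nd y l = 0"
proof -
  have K: "3 \<le> K1" "K1 + 2 < K2 - 1" "K2 + 3 \<le> K" "nd K = int N"
    and unit: "\<And>k. K1 - 1 \<le> k \<Longrightarrow> k \<le> K2 + 2 \<Longrightarrow> nd k = nd (k - 1) + 1"
    using mesh by (auto simp: is_mesh_def algebra_simps)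
  obtain k where k: "k \<in> {1..K}" "l \<in> elt_lattice nd k"
    using elements_cover[of K nd l] l K by auto
  have "l \<in> lattice N"
    using l K mesh_zero_node[OF mesh] by (simp add: lattice_def)
  then have ac: "sigma_ac N V K K1 K2 nd y l = sigma_ac_elt N V K K1 K2 nd y k"
    using elt_of_eqI[OF mesh k] by (simp add: sigma_ac_def wrap_lattice)
  consider "k \<in> KcT K K1 K2" | "K1 - 1 \<le> k" "k \<le> K1 + 2" | "K1 + 3 \<le> k" "k \<le> K2 - 2"
    | "K2 - 1 \<le> k" "k \<le> K2 + 2"
    using k(1) by (force simp: KcT_def Kc_def)
  then show ?thesis
  proof cases
    case 1
    have "k \<in> Kc K K1 K2" using 1 by (simp add: KcT_def)
    from out[OF this] have up: "l \<le> nd k - 3"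
      using k(2) by (auto simp: node_patch_def elt_lattice_def split: if_splits)
    have low: "nd (k - 1) + 4 \<le> l"
    proof (cases "k = 1")
      case False
      then have "k - 1 \<in> Kc K K1 K2" using 1 by (auto simp: KcT_def Kc_def)
      from out[OF this] show ?thesis
        using k(2) by (auto simp: node_patch_def elt_lattice_def split: if_splits)
    qed (use l in simp)
    obtain c where c: "\<And>m. m \<in> elt_lattice nd k \<Longrightarrow> bdiff N y m = c"
      using y k(1) unfolding Y_h_def by blast
    have g: "grad N nd y k = c"
      using c[of "nd k"] k(2) by (simp add: grad_def elt_lattice_def)
    have "sigma_a N V y l = deriv (W V) c"
    proof (rule sigma_a_eq_deriv_W[OF V])
      show "c > 0" using pos[OF k(1)] g by simp
      \<comment> \<open>The bounds \<open>low\<close> and \<open>up\<close> are exactly what keeps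
        all seven slopes inside the element \<open>k\<close>.\<close>
      show "bdiff N y m = c" if "m \<in> {l - 3..l + 3}" for m
        using that up low by (intro c) (auto simp: elt_lattice_def)
    qed
    then show ?thesis
      using 1 by (simp add: R_mo_lat_def ac sigma_ac_elt_def Let_def g)
  \<comment> \<open>Left interface: elements of one lattice spacing put \<open>nd k\<close> one to
    four points right of node \<open>K1 - 2\<close>. The fourth explains the longer patch
    there.\<close>
  next
    case 2
    have "l = nd k"
      using unit[of k] 2 k(2) K by (simp add: elt_lattice_def)
    moreover have "k = K1 - 1 \<or> k = K1 \<or> k = K1 + 1 \<or> k = K1 + 2"
      using 2 by auto
    ultimately have "l \<in> node_patch K1 K2 nd (K1 - 2)"
      using unit[of "K1 - 1"] unit[of K1] unit[of "K1 + 1"] unit[of "K1 + 2"] K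
      by (auto simp: node_patch_def add.commute)
    moreover have "K1 - 2 \<in> Kc K K1 K2" using K by (simp add: Kc_def)
    ultimately show ?thesis using out by blast
  next
    case 3
    have "l = nd k"
      using unit[of k] 3 k(2) K by (simp add: elt_lattice_def)
    moreover have "k \<notin> KcT K K1 K2" using 3 by (auto simp: KcT_def Kc_def)
    ultimately show ?thesis
      using 3 unfolding R_mo_lat_def ac by (simp add: sigma_ac_elt_def Let_def)
  \<comment> \<open>Right interface: \<open>nd k\<close> is zero to three points left of node
    \<open>K2 + 2\<close>, the third being covered by its longer patch.\<close>
  next
    case 4
    have "l = nd k"
      using unit[of k] 4 k(2) K by (simp add: elt_lattice_def)
    moreover have "k = K2 - 1 \<or> k = K2 \<or> k = K2 + 1 \<or> k = K2 + 2"
      using 4 by auto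
    ultimately have "l \<in> node_patch K1 K2 nd (K2 + 2)"
      using unit[of K2] unit[of "K2 + 1"] unit[of "K2 + 2"] K
      by (auto simp: node_patch_def add.commute)
    moreover have "K2 + 2 \<in> Kc K K1 K2" using K by (simp add: Kc_def)
    ultimately show ?thesis using out by blast
  qed
qed

lemma sum_R_mo_lat_le_eta:
  assumes N: "N > 0" and V: "Ck_on 3 V pot_dom" and mesh: "is_mesh N K K1 K2 nd"
    and y: "y \<in> Y_h N F K nd" and pos: "\<And>k. k \<in> {1..K} \<Longrightarrow> grad N nd y k > 0"
  shows "eps N * (\<Sum>l\<in>lattice N. (R_mo_lat N V K K1 K2 nd y l)\<^sup>2)
    \<le> (\<Sum>k\<in>Kc K K1 K2. (eta_mo N V K K1 K2 nd y k)\<^sup>2)"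
proof -
  define f where "f l = (R_mo_lat N V K K1 K2 nd y l)\<^sup>2" for l
  have K: "3 \<le> K1" "K1 + 2 < K2 - 1" "K2 + 3 \<le> K" "nd K = int N"
    using mesh by (auto simp: is_mesh_def)
  have per: "f (l + 2 * int N) = f l" for l
    using R_mo_lat_periodic[of y N F] y by (simp add: f_def Y_h_def)
  \<comment> \<open>The window is shifted by 3 so that the whole patch of node \<open>K\<close> lies at its right end and none
    of the patch of node \<open>0\<close> lies in it.\<close>
  have "(\<Sum>l\<in>lattice N. f l) = (\<Sum>l = - int N + 4..int N + 3. f l)"
    using sum_periodic_shift[of f "2 * int N" "- int N" 3] per N
    by (simp add: lattice_def add.commute)
  also have "\<dots> \<le> (\<Sum>k\<in>Kc K K1 K2. \<Sum>l\<in>node_patch K1 K2 nd k. f l)"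
  proof (rule sum_le_sum_cover)
    fix l assume l: "l \<in> {- int N + 4..int N + 3}" "f l \<noteq> 0"
    show "\<exists>k\<in>Kc K K1 K2. l \<in> node_patch K1 K2 nd k"
    proof (cases "l \<le> int N")
      case True
      show ?thesis
      proof (rule ccontr)
        assume "\<not> ?thesis"
        then have "R_mo_lat N V K K1 K2 nd y l = 0"
          using l True K mesh_zero_node[OF mesh]
          by (intro R_mo_lat_zero_outside_patches[OF V mesh y pos]) auto
        then show False using l by (simp add: f_def)
      qed
    next
      case False
      then have "l \<in> node_patch K1 K2 nd K" using l K by (auto simp: node_patch_def)
      moreover have "K \<in> Kc K K1 K2" using K by (simp add: Kc_def)
      ultimately show ?thesis by blast
    qed
  qed (auto simp: f_def Kc_def node_patch_def)
  finally have "eps N * (\<Sum>l\<in>lattice N. f l)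
      \<le> eps N * (\<Sum>k\<in>Kc K K1 K2. \<Sum>l\<in>node_patch K1 K2 nd k. f l)"
    by (intro mult_left_mono) (simp_all add: eps_def)
  then show ?thesis
    by (simp add: eta_mo_squared[OF mesh] f_def sum_distrib_left cong: sum.cong)
qed

subsection \<open>Elementwise redistribution\<close>

text \<open>Every interior node receives two halves; only the end nodes leave a defect.\<close>

lemma sum_adjacent_averages:
  fixes s :: "int \<Rightarrow> real"
  assumes "a \<le> b"
  shows "(\<Sum>k = a + 1..b. (s (k - 1) + s k) / 2) = (\<Sum>k = a + 1..b. s k) + (s a - s b) / 2"
  using assms
proof (induction b rule: int_ge_induct)
  case (step b)
  have "{a + 1..b + 1} = insert (b + 1) {a + 1..b}" using step by auto
  then show ?case using step by (simp add: field_simps)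
qed simp

text \<open>The nodes \<open>K1 - 2\<close> and \<open>K2 + 2\<close> border only one element of
  \<open>KcT\<close> each, so that element takes their whole indicator. The halves left over at
  nodes 0 and \<open>K\<close> cancel by periodicity.\<close>

lemma sum_eta_mo_eq_sum_eta_mo_elt:
  assumes mesh: "is_mesh N K K1 K2 nd" and y: "y \<in> Y_eps N F"
  shows "(\<Sum>k\<in>Kc K K1 K2. (eta_mo N V K K1 K2 nd y k)\<^sup>2)
    = (\<Sum>k\<in>KcT K K1 K2. (eta_mo_elt N V K K1 K2 nd y k)\<^sup>2)"
proof -
  \<comment> \<open>\<open>s\<close> uses the ordinary window at every index, so it also has a value
    at node 0, which the first element needs.\<close>
  define s where "s k = eps N * (\<Sum>l = nd k - 2..nd k + 3. (R_mo_lat N V K K1 K2 nd y l)\<^sup>2)" for k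
  let ?\<eta> = "eta_mo N V K K1 K2 nd y" and ?T = "eta_mo_elt N V K K1 K2 nd y"
  have K: "3 \<le> K1" "K1 + 2 < K2 - 1" "K2 + 3 \<le> K" "nd (0 + K) = nd 0 + 2 * int N"
    using mesh unfolding is_mesh_def by blast+
  have snn: "s k \<ge> 0" for k by (simp add: s_def eps_def sum_nonneg)
  have "s K = s 0"
    using K(4) sum_shift_interval_int[of "\<lambda>l. (R_mo_lat N V K K1 K2 nd y l)\<^sup>2"
        "nd 0 - 2" "2 * int N" "nd 0 + 3"]
    by (simp add: s_def R_mo_lat_periodic[OF y] add_ac add_diff_eq flip: diff_add_eq)
  have \<eta>: "(?\<eta> k)\<^sup>2 = s k" if "k \<in> Kc_int K K1 K2" for k
    using that snn[of k] by (simp add: eta_mo_def s_def Let_def)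
  have T: "(?T k)\<^sup>2 = (s (k - 1) + s k) / 2" if "k \<in> KcT_int K K1 K2" for k
  proof -
    have "?T k = sqrt ((s (k - 1) + s k) / 2)"
      using that by (simp add: eta_mo_elt_def s_def Let_def algebra_simps)
    then show ?thesis using snn[of k] snn[of "k - 1"] by simp
  qed
  have T1: "(?T (K1 - 2))\<^sup>2 = s (K1 - 3) / 2 + (?\<eta> (K1 - 2))\<^sup>2"
  proof -
    have "?T (K1 - 2) = sqrt (s (K1 - 3) / 2 + (?\<eta> (K1 - 2))\<^sup>2)"
      by (simp add: eta_mo_elt_def KcT_int_def s_def Let_def)
    then show ?thesis using snn[of "K1 - 3"] by simp
  qed
  have T2: "(?T (K2 + 3))\<^sup>2 = (?\<eta> (K2 + 2))\<^sup>2 + s (K2 + 3) / 2"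
  proof -
    have "?T (K2 + 3) = sqrt ((?\<eta> (K2 + 2))\<^sup>2 + s (K2 + 3) / 2)"
      using K by (simp add: eta_mo_elt_def KcT_int_def s_def Let_def add.commute)
    then show ?thesis using snn[of "K2 + 3"] by simp
  qed
  \<comment> \<open>Index \<open>K2 + 3\<close> is split off on both sides: as a node it is
    ordinary, but as an element it is exceptional.\<close>
  have Kc: "Kc K K1 K2 = insert (K1 - 2) (insert (K2 + 2)
      ({1..K1 - 3} \<union> insert (K2 + 3) {K2 + 4..K}))"
    and KcT: "KcT K K1 K2 = insert (K1 - 2) (insert (K2 + 3) ({1..K1 - 3} \<union> {K2 + 4..K}))"
    using K by (auto simp: Kc_def KcT_def)
  have int: "k \<in> Kc_int K K1 K2" "k \<in> KcT_int K K1 K2"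
    if "k \<in> {1..K1 - 3} \<union> {K2 + 4..K}" for k
    using that K by (auto simp: Kc_int_def KcT_int_def KcT_def Kc_def)
  have int': "K2 + 3 \<in> Kc_int K K1 K2"
    using K by (auto simp: Kc_int_def Kc_def)
  have disj: "{1..K1 - 3} \<inter> {K2 + 4..K} = {}" using K by auto
  have "(\<Sum>k\<in>Kc K K1 K2. (?\<eta> k)\<^sup>2) = (?\<eta> (K1 - 2))\<^sup>2 + (?\<eta> (K2 + 2))\<^sup>2 + s (K2 + 3)
      + (\<Sum>k = 1..K1 - 3. s k) + (\<Sum>k = K2 + 4..K. s k)"
    using K by (simp add: Kc sum.union_disjoint disj \<eta> int int')
  moreover have "(\<Sum>k\<in>KcT K K1 K2. (?T k)\<^sup>2) = (?T (K1 - 2))\<^sup>2 + (?T (K2 + 3))\<^sup>2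
      + (\<Sum>k = 1..K1 - 3. (s (k - 1) + s k) / 2) + (\<Sum>k = K2 + 4..K. (s (k - 1) + s k) / 2)"
    using K by (simp add: KcT sum.union_disjoint disj T int)
  moreover have "(\<Sum>k = 1..K1 - 3. (s (k - 1) + s k) / 2)
      = (\<Sum>k = 1..K1 - 3. s k) + (s 0 - s (K1 - 3)) / 2"
    using sum_adjacent_averages[of 0 "K1 - 3" s] K by simp
  moreover have "(\<Sum>k = K2 + 4..K. (s (k - 1) + s k) / 2)
      = (\<Sum>k = K2 + 4..K. s k) + (s (K2 + 3) - s K) / 2"
    using sum_adjacent_averages[of "K2 + 3" K s] K by (simp add: add.commute)
  ultimately show ?thesis
    using T1 T2 \<open>s K = s 0\<close> by (simp add: field_simps)
qed

theorem theorem3: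
  fixes N :: nat and F :: real and V :: "real \<times> real \<times> real \<times> real \<Rightarrow> real"
    and K K1 K2 :: int and nd :: "int \<Rightarrow> int" and y :: "int \<Rightarrow> real"
  assumes "N > 0" and "F > 0"
    and "Ck_on 3 V pot_dom"
    and "is_mesh N K K1 K2 nd"
    and "y \<in> Y_h N F K nd"
    and "(MIN k\<in>{1..K}. grad N nd y k) > 0"
    and "\<forall>k\<in>KcT K K1 K2. elt_size N nd k \<ge> 6 * eps N"
  shows "dual_norm N (R_mo N V K K1 K2 nd y)
           \<le> sqrt (\<Sum>k\<in>Kc K K1 K2. (eta_mo N V K K1 K2 nd y k)\<^sup>2)
       \<and> sqrt (\<Sum>k\<in>Kc K K1 K2. (eta_mo N V K K1 K2 nd y k)\<^sup>2)
           = sqrt (\<Sum>k\<in>KcT K K1 K2. (eta_mo_elt N V K K1 K2 nd y k)\<^sup>2)"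
proof
  have pos: "grad N nd y k > 0" if "k \<in> {1..K}" for k
  proof -
    have "(MIN k\<in>{1..K}. grad N nd y k) \<le> grad N nd y k"
      using that by (intro Min_le) auto
    then show ?thesis using assms(6) by simp
  qed
  have "R_mo N V K K1 K2 nd y v
      = eps N * (\<Sum>l\<in>lattice N. R_mo_lat N V K K1 K2 nd y l * bdiff N v l)" for v
    by (simp add: R_mo_def R_mo_lat_def left_diff_distrib sum_subtractf right_diff_distrib)
  then have "dual_norm N (R_mo N V K K1 K2 nd y)
      \<le> sqrt (eps N * (\<Sum>l\<in>lattice N. (R_mo_lat N V K K1 K2 nd y l)\<^sup>2))"
    by (rule dual_norm_le[OF assms(1)])
  also have "\<dots> \<le> sqrt (\<Sum>k\<in>Kc K K1 K2. (eta_mo N V K K1 K2 nd y k)\<^sup>2)"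
    using sum_R_mo_lat_le_eta[OF assms(1,3-5) pos] by simp
  finally show "dual_norm N (R_mo N V K K1 K2 nd y)
           \<le> sqrt (\<Sum>k\<in>Kc K K1 K2. (eta_mo N V K K1 K2 nd y k)\<^sup>2)" .
  show "sqrt (\<Sum>k\<in>Kc K K1 K2. (eta_mo N V K K1 K2 nd y k)\<^sup>2)
           = sqrt (\<Sum>k\<in>KcT K K1 K2. (eta_mo_elt N V K K1 K2 nd y k)\<^sup>2)"
    using sum_eta_mo_eq_sum_eta_mo_elt[OF assms(4), of y F V] assms(5) by (simp add: Y_h_def)
qed

end
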